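(* Let $k\ge1$ be an integer. For every integer $n\ge0$, $$\mathcal{P}_k(n)=\frac{1}{a[k]_1\cdots a[k]_{3k+1}}\sum_{J\subseteq\{\alpha_k+1,\ldots,k\}}\ \sum_{u=0}^{3k}\frac{(-1)^u}{(3k-u)!}\sum_{i_1+\cdots+i_{3k+1}=u}\frac{B_{i_1}\cdots B_{i_{3k+1}}}{i_1!\cdots i_{3k+1}!}\,a[k]_1^{i_1}\cdots a[k]_{3k+1}^{i_{3k+1}}\,(n-m_J)^{3k-u},$$ where $m_J=\sum_{i\in J}(3i-1)$ and the innermost sum runs over all tuples $(i_1,\ldots,i_{3k+1})$ of nonnegative integers with sum $u$.
   Context: A plane partition diamond of length $k$ of $n$ is a sequence $(a_1,\ldots,a_{3k+1})$ of nonnegative integers with sum $n$ such that, for all $0\le i\le k-1$, $a_{3i+1}\ge a_{3i+2}$, $a_{3i+1}\ge a_{3i+3}$, $a_{3i+2}\ge a_{3i+4}$, $a_{3i+3}\ge a_{3i+4}$; $\mathcal{D}_k(n)$ denotes the number of these, and $\mathcal{P}_k(n)$ is its polynomial part, defined as follows. For a sequence $\mathbf a=(a_1,\ldots,a_r)$ of positive integers, let $p_{\mathbf a}(n)$ be the number of nonnegative integer solutions of $a_1x_1+\cdots+a_rx_r=n$. The polynomial part $P_{\mathbf a}(n)$ of $p_{\mathbf a}(n)$ (the first Sylvester wave $W_1(n,\mathbf a)$) is the coefficient of $t^{-1}$ in the Laurent expansion at $t=0$ of $$\frac{e^{nt}}{(1-e^{-a_1t})\cdots(1-e^{-a_rt})};$$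 it is a polynomial in $n$ (and is evaluated as such at any integer). For $k\ge1$, $\mathbf a[k]=(a[k]_1,\ldots,a[k]_{3k+1})$ is the sequence with $a[k]_j=j$ if $j\not\equiv4\pmod6$ and $a[k]_j=j/2$ if $j\equiv4\pmod6$. With $\alpha_k=\lfloor\frac{k+1}{2}\rfloor$, the polynomial part of $\mathcal{D}_k(n)$ is $$\mathcal{P}_k(n):=\sum_{J\subseteq\{\alpha_k+1,\ldots,k\}}P_{\mathbf a[k]}(n-m_J),\qquad m_J=\sum_{i\in J}(3i-1),$$ where $J=\emptyset$ is allowed, with $m_\emptyset=0$. The Bernoulli numbers $B_\ell$ are defined by $\frac{t}{e^t-1}=\sum_{\ell\ge0}B_\ell\frac{t^\ell}{\ell!}$ (so $B_1=-\frac12$). Convention: $0^0=1$. *)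

theory Defs
  imports Complex_Main "HOL-Library.FuncSet"
    "HOL-Computational_Algebra.Formal_Laurent_Series"
begin

text \<open>Coefficients of the exponential generating function \<open>t / (e\<^sup>t - 1)\<close>, so \<open>B\<^sub>1 = -1/2\<close>.\<close>
definition bernoulli_number :: "nat \<Rightarrow> real" where
  "bernoulli_number l = fact l * fps_nth (fps_X / (fps_exp 1 - 1)) l"

text \<open>The sequence is \<open>a 1, ..., a r\<close>. The generating function is taken in the field of formal
  Laurent series in \<open>t\<close>. Since \<open>e\<^bsup>nt\<^esup>\<close> makes sense for every integer \<open>n\<close>, and each of its
  coefficients is a polynomial in \<open>n\<close>, this directly gives the values of the polynomial part
  at negative integers as well.\<close>
definition polynomial_part :: "nat \<Rightarrow> (nat \<Rightarrow> nat) \<Rightarrow> int \<Rightarrow> real" where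
  "polynomial_part r a n =
     fls_nth (fps_to_fls (fps_exp (of_int n)) /
              (\<Prod>j=1..r. 1 - fps_to_fls (fps_exp (- of_nat (a j))))) (-1)"

text \<open>The terms of \<open>\<^bold>a[k]\<close> do not depend on \<open>k\<close>; only its length \<open>3k + 1\<close> does.\<close>
definition diamond_seq :: "nat \<Rightarrow> nat" where
  "diamond_seq j = (if j mod 6 = 4 then j div 2 else j)"

definition diamond_alpha :: "nat \<Rightarrow> nat" where
  "diamond_alpha k = (k + 1) div 2"

definition diamond_shift :: "nat set \<Rightarrow> int" where
  "diamond_shift J = (\<Sum>i\<in>J. (3 * int i - 1))"

definition diamond_polynomial_part :: "nat \<Rightarrow> int \<Rightarrow> real" where
  "diamond_polynomial_part k n =
     (\<Sum>J\<in>Pow {diamond_alpha k + 1..k}.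
        polynomial_part (3 * k + 1) diamond_seq (n - diamond_shift J))"

end

theory Submission imports Defs begin

text \<open>Since \<open>t / (e\<^sup>t - 1)\<close> generates the \<open>B\<^sub>l / l!\<close>, substituting \<open>-at\<close> for \<open>t\<close> gives
  \<open>1 / (1 - e\<^bsup>-at\<^esup>) = (a t)\<^sup>-\<^sup>1 \<Sum>\<^sub>l B\<^sub>l (-a t)\<^sup>l / l!\<close>. Hence the residue defining the polynomial part for
  \<open>r\<close> parameters is, up to the factor \<open>1 / (a\<^sub>1 \<cdots> a\<^sub>r)\<close>, the coefficient of \<open>t\<^bsup>r-1\<^esup>\<close> in a product of
  \<open>r + 1\<close> power series.\<close>

definition bernoulli_fps :: "real fps" where
  "bernoulli_fps = Abs_fps (\<lambda>l. bernoulli_number l / fact l)"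

text \<open>Division of power series can be undone by multiplication once the divisor divides. Here
  \<open>fps_exp 1 - 1\<close> has subdegree 1, so it divides \<open>fps_X\<close>.\<close>

lemma bernoulli_fps_mult: "bernoulli_fps * (fps_exp 1 - 1) = fps_X"
proof -
  have eq: "bernoulli_fps = fps_X / (fps_exp 1 - 1)"
    by (simp add: bernoulli_fps_def bernoulli_number_def fps_eq_iff)
  have nz: "fps_exp (1::real) - 1 \<noteq> 0"
    by (metis fps_exp_0 fps_exp_eq_iff eq_iff_diff_eq_0 zero_neq_one)
  have "subdegree (fps_exp (1::real) - 1) = 1"
    by (rule subdegreeI) auto
  then have "fps_exp (1::real) - 1 dvd fps_X"
    using nz by (simp add: fps_dvd_iff)
  then show ?thesis
    by (simp add: eq)
qed

text \<open>This is \<open>bernoulli_fps_mult\<close> composed with \<open>-c t\<close>. It is kept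
  multiplied out because \<open>1 - fps_exp (- c)\<close> has constant term 0 and so is no unit
  among power series.\<close>

lemma one_minus_exp_mult_bernoulli_fps:
  "(1 - fps_exp (- c)) * (bernoulli_fps oo (fps_const (- c) * fps_X)) = fps_const c * fps_X"
proof -
  let ?m = "fps_const (- c) * fps_X"
  have "(bernoulli_fps oo ?m) * ((fps_exp 1 - 1) oo ?m) = fps_X oo ?m"
    by (simp flip: fps_compose_mult_distrib bernoulli_fps_mult)
  then have "(bernoulli_fps oo ?m) * (fps_exp (- c) - 1) = ?m"
    by (simp add: fps_compose_sub_distrib)
  also have "?m = - (fps_const c * fps_X)"
    by (simp flip: fps_const_neg)
  finally show ?thesis
    by (simp add: algebra_simps)
qed

text \<open>The rule \<open>fps_prod_nth'\<close> indexes the sum by multisets of size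
  \<open>n\<close> over \<open>A\<close>. These correspond to their multiplicity functions, made
  unique by extensionality outside \<open>A\<close>.\<close>

lemma fps_prod_nth_PiE:
  fixes f :: "'b \<Rightarrow> 'a::comm_ring_1 fps"
  assumes "finite A"
  shows "fps_nth (\<Prod>x\<in>A. f x) n =
    (\<Sum>i\<in>{i \<in> A \<rightarrow>\<^sub>E UNIV. (\<Sum>x\<in>A. i x) = n}. \<Prod>x\<in>A. fps_nth (f x) (i x))"
proof -
  let ?S = "multisets_of_size A n" and ?T = "{i \<in> A \<rightarrow>\<^sub>E UNIV. (\<Sum>x\<in>A. i x) = n}"
  let ?M = "\<lambda>i. \<Sum>x\<in>A. replicate_mset (i x) x"
  have count: "count (?M i) y = (if y \<in> A then i y else 0)" for i y
    using assms by (simp add: count_sum)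
  have size: "size X = (\<Sum>x\<in>A. count X x)" if "set_mset X \<subseteq> A" for X
    unfolding size_multiset_overloaded_eq
    using assms that by (intro sum.mono_neutral_left) (auto simp: count_eq_zero_iff)
  have set: "set_mset (?M i) \<subseteq> A" for i
    by (auto simp: count simp flip: count_greater_zero_iff split: if_splits)
  have "(\<Sum>X\<in>?S. \<Prod>x\<in>A. fps_nth (f x) (count X x)) =
    (\<Sum>i\<in>?T. \<Prod>x\<in>A. fps_nth (f x) (i x))"
  proof (rule sum.reindex_bij_witness[of _ ?M "\<lambda>X. restrict (count X) A"])
    fix X assume "X \<in> ?S"
    then have X: "set_mset X \<subseteq> A" "size X = n"
      by (auto simp: multisets_of_size_def)
    show "?M (restrict (count X) A) = X"
      using X by (intro multiset_eqI) (auto simp: count count_eq_zero_iff)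
    show "restrict (count X) A \<in> ?T"
      using X size[of X] by simp
    show "(\<Prod>x\<in>A. fps_nth (f x) (restrict (count X) A x)) = (\<Prod>x\<in>A. fps_nth (f x) (count X x))"
      by simp
  next
    fix i assume i: "i \<in> ?T"
    then show "restrict (count (?M i)) A = i"
      by (intro extensionalityI[of _ A]) (auto simp: count PiE_iff)
    show "?M i \<in> ?S"
      using i set[of i] size[OF set, of i] by (simp add: multisets_of_size_def count)
  qed
  then show ?thesis
    by (simp add: fps_prod_nth' assms)
qed

lemma polynomial_part_eq_fps_nth:
  assumes pos: "\<forall>j\<in>{1..r}. a j > 0" and "r \<ge> 1"
  shows "polynomial_part r a n = 1 / (\<Prod>j=1..r. real (a j)) *
    fps_nth ((\<Prod>j=1..r. bernoulli_fps oo (fps_const (- real (a j)) * fps_X)) *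
      fps_exp (of_int n)) (r - 1)"
proof -
  let ?b = "\<lambda>j. bernoulli_fps oo (fps_const (- real (a j)) * fps_X)"
  let ?d = "\<lambda>j. 1 - fps_exp (- real (a j))"
  define B where "B = (\<Prod>j=1..r. ?b j)"
  define P where "P = (\<Prod>j=1..r. real (a j))"
  define D where "D = (\<Prod>j=1..r. ?d j)"
  define E where "E = fps_exp (real_of_int n)"
  have "P > 0"
    unfolding P_def using pos by (intro prod_pos) auto
  have "(\<Prod>j\<in>J. fps_const (real (a j)) * fps_X) =
      fps_const (\<Prod>j\<in>J. real (a j)) * fps_X ^ card J" if "finite J" for J
    using that by (induction J rule: finite_induct) (simp_all add: mult_ac flip: fps_const_mult)
  from this[of "{1..r}"] have DB: "D * B = fps_const P * fps_X ^ r"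
    by (simp add: D_def B_def P_def one_minus_exp_mult_bernoulli_fps flip: prod.distrib)
  then have "D \<noteq> 0"
    using \<open>P > 0\<close> by auto
  have fls_D: "(\<Prod>j\<in>J. 1 - fps_to_fls (fps_exp (- real (a j)))) = fps_to_fls (\<Prod>j\<in>J. ?d j)" for J
    by (induction J rule: infinite_finite_induct) (simp_all add: fls_times_fps_to_fls)
  \<comment> \<open>The quotient identity wanted next, cross-multiplied; it is \<open>DB\<close>
    times \<open>E\<close>.\<close>
  have "fls_const P * fls_X ^ r * fps_to_fls E = fps_to_fls D * fps_to_fls (B * E)"
    unfolding fls_times_fps_to_fls[symmetric] mult.assoc[symmetric] DB
    by (simp add: fls_times_fps_to_fls fps_to_fls_power)
  then have "fps_to_fls E / fps_to_fls D = fps_to_fls (B * E) / (fls_const P * fls_X ^ r)"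
    using \<open>D \<noteq> 0\<close> \<open>P > 0\<close> by (simp add: frac_eq_eq fls_const_nonzero mult_ac)
  \<comment> \<open>Dividing by t^r shifts indices by \<open>r\<close>, which turns the coefficient
    of t^(-1) into that of t^(r-1).\<close>
  also have "\<dots> = fls_const (1 / P) * fls_shift (int r) (fps_to_fls (B * E))"
  proof -
    have "fls_const P * fls_const (1 / P) = 1" "fls_X ^ r * fls_shift (int r) F = F" for F :: "real fls"
      using \<open>P > 0\<close> by (simp_all add: fls_X_power_times_conv_shift(1))
    then have "fls_const P * fls_X ^ r * (fls_const (1 / P) * fls_shift (int r) F) = F" for F
      by (metis (no_types) mult.assoc mult.left_commute mult_1)
    then show ?thesis
      using \<open>P > 0\<close> by (simp add: nonzero_divide_eq_eq fls_const_nonzero mult.commute)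
  qed
  finally show ?thesis
    unfolding polynomial_part_def fls_D
      B_def[symmetric] P_def[symmetric] D_def[symmetric] E_def[symmetric]
    using \<open>r \<ge> 1\<close> by (simp add: nat_diff_distrib)
qed

text \<open>In the Cauchy product with e^(nt), index \<open>u\<close> goes to the Bernoulli factors,
  and the exponential contributes n^(r-1-u) / (r-1-u)!.\<close>

lemma polynomial_part_eq_bernoulli:
  assumes "\<forall>j\<in>{1..r}. a j > 0" and "r \<ge> 1"
  shows "polynomial_part r a n = 1 / (\<Prod>j=1..r. real (a j)) *
    (\<Sum>u=0..r-1. (- 1) ^ u / fact (r - 1 - u) *
       (\<Sum>i\<in>{i \<in> {1..r} \<rightarrow>\<^sub>E UNIV. (\<Sum>j=1..r. i j) = u}.
          (\<Prod>j=1..r. bernoulli_number (i j)) / (\<Prod>j=1..r. fact (i j)) *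
          (\<Prod>j=1..r. real (a j) ^ i j) * of_int n ^ (r - 1 - u)))"
proof -
  let ?S = "\<lambda>u. {i \<in> {1..r} \<rightarrow>\<^sub>E UNIV. (\<Sum>j=1..r. i j) = u}"
  let ?c = "\<lambda>i. (\<Prod>j=1..r. bernoulli_number (i j)) / (\<Prod>j=1..r. fact (i j)) *
    (\<Prod>j=1..r. real (a j) ^ i j)"
  \<comment> \<open>The signs are split off because on \<open>?S u\<close> their product is (-1)^u,
    independent of \<open>i\<close>.\<close>
  have "(\<Prod>j=1..r. (- real (a j)) ^ i j * (bernoulli_number (i j) / fact (i j))) =
      (\<Prod>j=1..r. (- 1) ^ i j) * ?c i" for i
    by (subst power_minus) (simp add: prod.distrib prod_dividef mult_ac)
  then have "fps_nth (\<Prod>j=1..r. bernoulli_fps oo (fps_const (- real (a j)) * fps_X)) u =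
      (- 1) ^ u * (\<Sum>i\<in>?S u. ?c i)" for u
    unfolding fps_prod_nth_PiE[OF finite_atLeastAtMost] fps_nth_compose_linear sum_distrib_left
    by (intro sum.cong refl) (auto simp: bernoulli_fps_def simp flip: power_sum)
  then have "fps_nth ((\<Prod>j=1..r. bernoulli_fps oo (fps_const (- real (a j)) * fps_X)) *
      fps_exp (of_int n)) (r - 1) =
      (\<Sum>u=0..r-1. (- 1) ^ u / fact (r - 1 - u) * (\<Sum>i\<in>?S u. ?c i * of_int n ^ (r - 1 - u)))"
    unfolding fps_mult_nth sum_distrib_right[symmetric]
    by (intro sum.cong refl) simp
  then show ?thesis
    by (simp only: polynomial_part_eq_fps_nth[OF assms])
qed

theorem theorem5p3:
  fixes k n :: nat
  assumes "k \<ge> 1"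
  shows "diamond_polynomial_part k (int n) =
    1 / (\<Prod>j=1..3*k+1. real (diamond_seq j)) *
    (\<Sum>J\<in>Pow {diamond_alpha k + 1..k}. \<Sum>u=0..3*k.
       (- 1) ^ u / fact (3*k - u) *
       (\<Sum>i\<in>{i \<in> {1..3*k+1} \<rightarrow>\<^sub>E (UNIV :: nat set). (\<Sum>j=1..3*k+1. i j) = u}.
          (\<Prod>j=1..3*k+1. bernoulli_number (i j)) / (\<Prod>j=1..3*k+1. fact (i j)) *
          (\<Prod>j=1..3*k+1. real (diamond_seq j) ^ i j) *
          of_int (int n - diamond_shift J) ^ (3*k - u)))"
proof -
  \<comment> \<open>In the halved case \<open>j mod 6 = 4\<close> forces \<open>j\<close> to be at
    least 4, so \<open>j div 2\<close> stays positive.\<close>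
  have "diamond_seq j > 0" if "j > 0" for j
    using that mod_less_eq_dividend[of j 6]
    by (cases "j mod 6 = 4") (simp_all add: diamond_seq_def div_greater_zero_iff)
  then have "\<forall>j\<in>{1..3 * k + 1}. diamond_seq j > 0"
    by simp
  note eq = polynomial_part_eq_bernoulli[of "3 * k + 1" diamond_seq, OF this le_add2,
      unfolded add_diff_cancel_right']
  \<comment> \<open>The prefactor is the same for every \<open>J\<close>, so it leaves the outer
    sum.\<close>
  show ?thesis
    unfolding diamond_polynomial_part_def eq by (rule sum_distrib_left[symmetric])
qed

end
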